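(* Let $\mathcal{F}_{\mathrm{cubic}}$ be the family of graphs described in the context. If $G \in \mathcal{F}_{\mathrm{cubic}}$ has order $n$, then $n \ge 16$, $n \equiv 0 \pmod 8$, and $i(G) = \frac{3}{8}n$.
   Context: A set $S$ of vertices of a graph $G$ is an independent dominating set if $S$ is independent and every vertex not in $S$ is adjacent to a vertex of $S$; $i(G)$ denotes the minimum cardinality of an independent dominating set of $G$. Let $X$ be the graph on vertices $a_1,a_2,b_1,b_2,b_3,c_1,c_2,c_3$ with edges $a_jb_i$ for all $j\in\{1,2\}$, $i\in\{1,2,3\}$, the edges $b_ic_i$ for $i\in\{1,2,3\}$, and the edge $c_2c_3$. (So in $X$, $c_1$ has degree $1$, and $c_2,c_3$ are the two adjacent vertices of degree $2$.) Let $Y$ be the graph obtained from $X$ by adding the edge $c_1c_2$ (so in $Y$ the vertices of degree $2$ are $c_1$ and $c_3$). The family $\mathcal{F}_{\mathrm{cubic}}$: take a cycle $v_1v_2\ldots v_kv_1$ with $k\ge 2$ (for $k=2$ this means two vertices joined by two parallel edges) and color each $v_i$ red or blue so that the number of red vertices is even; when $k=2$ both vertices are blue. Replace each red $v_i$ by a copy $G_i$ of $X$ and each blue $v_i$ by a copy $G_i$ of $Y$. Partition the $X$-copies into pairs; for each pair $\{X_1,X_2\}$, if $v_{j1},v_{j2}$ are the two adjacent degree-2 vertices of $X_j$ ($j=1,2$), add the edges $v_{11}v_{21}$ and $v_{12}v_{22}$. For an $X$-copy $G_i$ let $x_i$ be its vertex of degree $1$ in $X$; for a $Y$-copy $G_i$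 let $y_i^1,y_i^2$ be its two vertices of degree $2$ in $Y$. For each $i\in[k]$ (indices modulo $k$) add one edge between $G_i$ and $G_{i+1}$: $x_ix_{i+1}$ if both are $X$-copies; $y_i^2y_{i+1}^1$ if both are $Y$-copies; $x_iy_{i+1}^1$ if $G_i$ is an $X$-copy and $G_{i+1}$ a $Y$-copy; $y_i^2x_{i+1}$ if $G_i$ is a $Y$-copy and $G_{i+1}$ an $X$-copy. The resulting connected cubic graphs form $\mathcal{F}_{\mathrm{cubic}}$. *)

theory Defs
  imports
    Complex_Main
    "HOL-Library.Disjoint_Sets"
    "HOL-Number_Theory.Cong"
    "Graph_Theory.Graph_Theory"
begin

text \<open>Undirected graphs are symmetric digraphs, as in \<^locale>\<open>graph\<close>: an edge is
  represented by its two opposite arcs. Below, each edge is listed (at least) once with an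
  arbitrary direction and \<^const>\<open>mk_symmetric\<close> adds the reverse arcs.\<close>

definition independent_set :: "('a, 'b) pre_digraph \<Rightarrow> 'a set \<Rightarrow> bool" where
  "independent_set G S \<longleftrightarrow> S \<subseteq> verts G \<and> (\<forall>u\<in>S. \<forall>v\<in>S. \<not> u \<rightarrow>\<^bsub>G\<^esub> v)"

definition independent_dominating_set :: "('a, 'b) pre_digraph \<Rightarrow> 'a set \<Rightarrow> bool" where
  "independent_dominating_set G S \<longleftrightarrow>
     independent_set G S \<and> (\<forall>v \<in> verts G - S. \<exists>u\<in>S. v \<rightarrow>\<^bsub>G\<^esub> u)"

definition independent_domination_number :: "('a, 'b) pre_digraph \<Rightarrow> nat" where
  "independent_domination_number G = Min {card S | S. independent_dominating_set G S}"

datatype gadget_vertex = A1 | A2 | B1 | B2 | B3 | C1 | C2 | C3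

definition X_graph :: "gadget_vertex pair_pre_digraph" where
  "X_graph = mk_symmetric (with_proj
     \<lparr> pverts = UNIV,
       parcs = {A1, A2} \<times> {B1, B2, B3} \<union> {(B1, C1), (B2, C2), (B3, C3)} \<union> {(C2, C3)} \<rparr>)"

definition Y_graph :: "gadget_vertex pair_pre_digraph" where
  "Y_graph = X_graph \<lparr> parcs := parcs X_graph \<union> {(C1, C2), (C2, C1)} \<rparr>"

lemma UNIV_gadget_vertex: "UNIV = {A1, A2, B1, B2, B3, C1, C2, C3}"
  using gadget_vertex.exhaust by auto

lemma X_degree_1: "{v. out_degree X_graph v = 1} = {C1}"
  and X_degree_2: "{v. out_degree X_graph v = 2} = {C2, C3}"
  and Y_degree_2: "{v. out_degree Y_graph v = 2} = {C1, C3}"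
proof -
  have X: "parcs X_graph `` {v} = (case v of
      A1 \<Rightarrow> {B1, B2, B3} | A2 \<Rightarrow> {B1, B2, B3}
    | B1 \<Rightarrow> {A1, A2, C1} | B2 \<Rightarrow> {A1, A2, C2} | B3 \<Rightarrow> {A1, A2, C3}
    | C1 \<Rightarrow> {B1} | C2 \<Rightarrow> {B2, C3} | C3 \<Rightarrow> {B3, C2})" (is "_ = ?N v") for v
  proof (rule set_eqI)
    fix w show "w \<in> parcs X_graph `` {v} \<longleftrightarrow> w \<in> ?N v"
      by (cases v; cases w; simp add: X_graph_def parcs_mk_symmetric)
  qed
  have Y: "parcs Y_graph `` {v} = (case v of
      A1 \<Rightarrow> {B1, B2, B3} | A2 \<Rightarrow> {B1, B2, B3}
    | B1 \<Rightarrow> {A1, A2, C1} | B2 \<Rightarrow> {A1, A2, C2} | B3 \<Rightarrow> {A1, A2, C3}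
    | C1 \<Rightarrow> {B1, C2} | C2 \<Rightarrow> {B2, C1, C3} | C3 \<Rightarrow> {B3, C2})" (is "_ = ?N v") for v
  proof (rule set_eqI)
    fix w show "w \<in> parcs Y_graph `` {v} \<longleftrightarrow> w \<in> ?N v"
      by (cases v; cases w; simp add: Y_graph_def X_graph_def parcs_mk_symmetric)
  qed
  have deg: "out_degree (with_proj G) v = card (parcs G `` {v})"
    for G :: "gadget_vertex pair_pre_digraph" and v
  proof -
    have "out_arcs (with_proj G) v = Pair v ` (parcs G `` {v})"
      by (force simp: out_arcs_def)
    then show ?thesis
      by (simp add: out_degree_def card_image inj_on_def)
  qed
  have "(out_degree X_graph v = 1) = (v \<in> {C1})" "(out_degree X_graph v = 2) = (v \<in> {C2, C3})"
    "(out_degree Y_graph v = 2) = (v \<in> {C1, C3})" for v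
    by (cases v; simp add: deg X Y)+
  then show "{v. out_degree X_graph v = 1} = {C1}" "{v. out_degree X_graph v = 2} = {C2, C3}"
    "{v. out_degree Y_graph v = 2} = {C1, C3}"
    by (simp_all only: Collect_mem_eq)
qed

text \<open>The choices made in the construction, with the cycle vertices indexed by \<open>0, \<dots>, k - 1\<close>:
  \<open>red\<close> is the set of red indices (the copies of \<open>X\<close>), \<open>P\<close> is the partition of these copies
  into pairs, \<open>v1 i\<close> and \<open>v2 i\<close> name the two adjacent vertices of degree 2 of the \<open>X\<close>-copy \<open>i\<close>
  (in either order), and \<open>y1 i\<close> and \<open>y2 i\<close> name the two vertices of degree 2 of the \<open>Y\<close>-copy
  \<open>i\<close> (in either order). The vertex \<open>x\<^sub>i\<close> of an \<open>X\<close>-copy is always \<^const>\<open>C1\<close>.\<close>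

locale cubic_construction =
  fixes k :: nat and red :: "nat set" and P :: "nat set set"
    and v1 v2 y1 y2 :: "nat \<Rightarrow> gadget_vertex"
  assumes k_ge_2: "k \<ge> 2"
    and red_subset: "red \<subseteq> {..<k}"
    and even_red: "even (card red)"
    and no_red_if_k_2: "k = 2 \<Longrightarrow> red = {}"
    and pairing: "partition_on red P"
    and pair_card: "p \<in> P \<Longrightarrow> card p = 2"
    and X_labels: "i \<in> red \<Longrightarrow> {v1 i, v2 i} = {C2, C3}"
    and Y_labels: "i \<in> {..<k} - red \<Longrightarrow> {y1 i, y2 i} = {C1, C3}"

definition copy_edges :: "nat \<Rightarrow> nat set \<Rightarrow> (nat \<times> gadget_vertex) rel" where
  "copy_edges k red =
     {((i, u), (i, w)) | i u w. i < k \<and> (u, w) \<in> parcs (if i \<in> red then X_graph else Y_graph)}"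

definition pair_edges ::
    "nat set set \<Rightarrow> (nat \<Rightarrow> gadget_vertex) \<Rightarrow> (nat \<Rightarrow> gadget_vertex) \<Rightarrow> (nat \<times> gadget_vertex) rel" where
  "pair_edges P v1 v2 =
     {((i, v1 i), (j, v1 j)) | i j. {i, j} \<in> P} \<union> {((i, v2 i), (j, v2 j)) | i j. {i, j} \<in> P}"

definition cycle_edges ::
    "nat \<Rightarrow> nat set \<Rightarrow> (nat \<Rightarrow> gadget_vertex) \<Rightarrow> (nat \<Rightarrow> gadget_vertex) \<Rightarrow> (nat \<times> gadget_vertex) rel" where
  "cycle_edges k red y1 y2 =
     {((i, if i \<in> red then C1 else y2 i), (j, if j \<in> red then C1 else y1 j))
       | i j. i < k \<and> j = Suc i mod k}"

definition cubic_graph ::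
    "nat \<Rightarrow> nat set \<Rightarrow> nat set set \<Rightarrow> (nat \<Rightarrow> gadget_vertex) \<Rightarrow> (nat \<Rightarrow> gadget_vertex) \<Rightarrow>
     (nat \<Rightarrow> gadget_vertex) \<Rightarrow> (nat \<Rightarrow> gadget_vertex) \<Rightarrow> (nat \<times> gadget_vertex) pair_pre_digraph" where
  "cubic_graph k red P v1 v2 y1 y2 = mk_symmetric (with_proj
     \<lparr> pverts = {..<k} \<times> UNIV,
       parcs = copy_edges k red \<union> pair_edges P v1 v2 \<union> cycle_edges k red y1 y2 \<rparr>)"

text \<open>The family is closed under isomorphism.\<close>

definition F_cubic :: "('a, 'b) pre_digraph set" where
  "F_cubic = {G. \<exists>k red P v1 v2 y1 y2. cubic_construction k red P v1 v2 y1 y2 \<and>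
     digraph_iso (with_proj (cubic_graph k red P v1 v2 y1 y2)) G}"

end

theory Submission
  imports Defs
begin

text \<open>
  An independent dominating set \<open>S\<close> meets every copy in at least three vertices. If \<open>S\<close> contains
  some \<open>b\<^sub>i\<close> of the copy, it contains neither \<open>a\<^sub>1\<close> nor \<open>a\<^sub>2\<close>, so each \<open>b\<^sub>m\<close> outside \<open>S\<close> is dominated
  by \<open>c\<^sub>m\<close>, and \<open>S\<close> meets \<open>{b\<^sub>m, c\<^sub>m}\<close> for \<open>m = 1, 2, 3\<close>. Otherwise it contains \<open>a\<^sub>1\<close> and \<open>a\<^sub>2\<close>, and
  also some \<open>c\<^sub>m\<close>: in a \<open>Y\<close>-copy, \<open>c\<^sub>2\<close> has no neighbour outside the copy; in an \<open>X\<close>-copy, \<open>c\<^sub>2\<close> and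
  \<open>c\<^sub>3\<close> would otherwise be dominated by the two adjacent vertices of degree 2 of the partner copy.
  Conversely, the vertices \<open>b\<^sub>1, b\<^sub>2, b\<^sub>3\<close> of all copies form an independent dominating set.
\<close>

section \<open>Invariance of the independent domination number under isomorphism\<close>

lemma independent_dominating_set_app_iso:
  assumes iso: "pre_digraph.digraph_isomorphism G f" and S: "independent_dominating_set G S"
  shows "independent_dominating_set (app_iso f G) (iso_verts f ` S)"
proof -
  interpret wf_digraph G
    using iso by (simp add: pre_digraph.digraph_isomorphism_def)
  have sub: "S \<subseteq> verts G"
    using S by (simp add: independent_dominating_set_def independent_set_def)
  \<comment> \<open>Injectivity on vertices makes adjacency reflected as well as preserved:
    reflection carries independence over to the image, preservation carries domination.\<close>
  have adj: "iso_verts f u \<rightarrow>\<^bsub>app_iso f G\<^esub> iso_verts f v \<longleftrightarrow> u \<rightarrow>\<^bsub>G\<^esub> v"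
    if "u \<in> verts G" "v \<in> verts G" for u v
    using that iso adj_in_verts
    by (auto simp: arcs_ends_app_iso_eq intro!: rev_image_eqI)
  show ?thesis
    using S sub adj unfolding independent_dominating_set_def independent_set_def
    by (auto simp: subset_iff) blast
qed

lemma independent_domination_number_app_iso:
  assumes iso: "pre_digraph.digraph_isomorphism G f"
  shows "independent_domination_number (app_iso f G) = independent_domination_number G"
proof -
  interpret wf_digraph G
    using iso by (simp add: pre_digraph.digraph_isomorphism_def)
  \<comment> \<open>Stated for arbitrary \<open>H\<close> and \<open>h\<close>, so that it applies
    both to \<open>f\<close> and to its inverse; the two inclusions then give equality.\<close>
  have sub: "{card S | S. independent_dominating_set H S} \<subseteq>
      {card S | S. independent_dominating_set (app_iso h H) S}"
    if h: "pre_digraph.digraph_isomorphism H h"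
    for H :: "('p, 'q) pre_digraph" and h :: "('p, 'q, 'r, 's) digraph_isomorphism"
  proof safe
    fix S assume S: "independent_dominating_set H S"
    then have "inj_on (iso_verts h) S"
      using pre_digraph.digraph_isomorphism_inj_on_verts[OF h]
      by (auto simp: independent_dominating_set_def independent_set_def intro: inj_on_subset)
    then show "\<exists>T. card S = card T \<and> independent_dominating_set (app_iso h H) T"
      using independent_dominating_set_app_iso[OF h S] by (metis card_image)
  qed
  show ?thesis
    using sub[OF iso] sub[OF digraph_isomorphism_invI[OF iso]] iso
    by (simp add: independent_domination_number_def)
qed

section \<open>Neighbourhoods inside the gadgets\<close>

lemma X_graph_arc_iff:
  "(u, w) \<in> parcs X_graph \<longleftrightarrow> w \<in> (case u of
      A1 \<Rightarrow> {B1, B2, B3} | A2 \<Rightarrow> {B1, B2, B3}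
    | B1 \<Rightarrow> {A1, A2, C1} | B2 \<Rightarrow> {A1, A2, C2} | B3 \<Rightarrow> {A1, A2, C3}
    | C1 \<Rightarrow> {B1} | C2 \<Rightarrow> {B2, C3} | C3 \<Rightarrow> {B3, C2})"
  by (cases u; cases w; simp add: X_graph_def parcs_mk_symmetric)

lemma Y_graph_arc_iff:
  "(u, w) \<in> parcs Y_graph \<longleftrightarrow> w \<in> (case u of
      A1 \<Rightarrow> {B1, B2, B3} | A2 \<Rightarrow> {B1, B2, B3}
    | B1 \<Rightarrow> {A1, A2, C1} | B2 \<Rightarrow> {A1, A2, C2} | B3 \<Rightarrow> {A1, A2, C3}
    | C1 \<Rightarrow> {B1, C2} | C2 \<Rightarrow> {B2, C1, C3} | C3 \<Rightarrow> {B3, C2})"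
  by (cases u; cases w; simp add: Y_graph_def X_graph_arc_iff)

lemma X_graph_arc_sym: "(u, w) \<in> parcs X_graph \<Longrightarrow> (w, u) \<in> parcs X_graph"
  by (cases u; cases w; simp add: X_graph_arc_iff)

lemma Y_graph_arc_sym: "(u, w) \<in> parcs Y_graph \<Longrightarrow> (w, u) \<in> parcs Y_graph"
  by (cases u; cases w; simp add: Y_graph_arc_iff)

lemma copy_edges_iff:
  "((i, u), (j, w)) \<in> copy_edges k red \<longleftrightarrow>
     j = i \<and> i < k \<and> (u, w) \<in> parcs (if i \<in> red then X_graph else Y_graph)"
  unfolding copy_edges_def by blast

lemma finite_gadget_vertex_set: "finite (T :: gadget_vertex set)"
proof (rule finite_subset[OF subset_UNIV])
  show "finite (UNIV :: gadget_vertex set)" by (simp add: UNIV_gadget_vertex)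
qed

section \<open>Neighbourhoods in the cubic graph\<close>

context cubic_construction
begin

abbreviation cubic where
  "cubic \<equiv> with_proj (cubic_graph k red P v1 v2 y1 y2)"

definition link_edges :: "(nat \<times> gadget_vertex) rel" where
  "link_edges = pair_edges P v1 v2 \<union> cycle_edges k red y1 y2"

lemma verts_cubic: "verts cubic = {..<k} \<times> UNIV"
  by (simp add: cubic_graph_def)

text \<open>Both gadgets are symmetric, hence so is \<open>copy_edges\<close>; only
  \<open>link_edges\<close> has to be read in both directions.\<close>

lemma cubic_arc_iff:
  "p \<rightarrow>\<^bsub>cubic\<^esub> q \<longleftrightarrow> (p, q) \<in> copy_edges k red \<or> (p, q) \<in> link_edges \<or> (q, p) \<in> link_edges"
proof -
  have "(p, q) \<in> copy_edges k red" if "(q, p) \<in> copy_edges k red"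
    using that X_graph_arc_sym Y_graph_arc_sym
    by (cases p; cases q) (auto simp: copy_edges_iff split: if_splits)
  moreover have "p \<rightarrow>\<^bsub>cubic\<^esub> q \<longleftrightarrow> (\<exists>e \<in> copy_edges k red \<union> link_edges. e = (p, q) \<or> e = (q, p))"
    by (simp add: cubic_graph_def link_edges_def parcs_mk_symmetric bex_Un prod_eq_iff conj_commute
        eq_commute)
  ultimately show ?thesis by blast
qed

lemma pair_in_red: "{i, j} \<in> P \<Longrightarrow> i \<in> red \<and> j \<in> red"
  using partition_onD1[OF pairing] by blast

text \<open>Blocks sharing \<open>i\<close> coincide by disjointness, and having two elements
  excludes \<open>i = j\<close> and \<open>i = l\<close>. Thus an X-copy has only one
  partner.\<close>

lemma pair_unique:
  assumes "{i, j} \<in> P" "{i, l} \<in> P"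
  shows "j = l"
proof -
  have "{i, j} \<inter> {i, l} \<noteq> {}" by blast
  then have "{i, j} = {i, l}"
    using assms partition_onD2[OF pairing] disjointD by blast
  moreover have "i \<noteq> j" "i \<noteq> l"
    using assms pair_card by fastforce+
  ultimately show ?thesis by (auto simp: doubleton_eq_iff)
qed

lemma X_label_cases:
  assumes "i \<in> red"
  obtains "v1 i = C2" "v2 i = C3" | "v1 i = C3" "v2 i = C2"
  using X_labels[OF assms] that unfolding doubleton_eq_iff by blast

lemma pair_edges_ends:
  assumes "((i, u), (j, w)) \<in> pair_edges P v1 v2"
  shows "{i, j} \<in> P \<and> i \<in> red \<and> j \<in> red \<and> u \<in> {C2, C3} \<and> w \<in> {C2, C3} \<and>
    (u = v1 i \<and> w = v1 j \<or> u = v2 i \<and> w = v2 j)"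
proof -
  have ij: "{i, j} \<in> P" "u = v1 i \<and> w = v1 j \<or> u = v2 i \<and> w = v2 j"
    using assms unfolding pair_edges_def by blast+
  then show ?thesis
    using pair_in_red[OF ij(1)] X_labels[of i] X_labels[of j] by blast
qed

lemma cycle_edges_ends:
  assumes "((i, u), (j, w)) \<in> cycle_edges k red y1 y2"
  shows "(if i \<in> red then u = C1 else u \<in> {C1, C3}) \<and> (if j \<in> red then w = C1 else w \<in> {C1, C3})"
proof -
  have "i < k" "j < k" using assms k_ge_2 by (auto simp: cycle_edges_def)
  then show ?thesis
    using assms Y_labels[of i] Y_labels[of j] by (auto simp: cycle_edges_def)
qed

lemma link_edges_ends:
  assumes "((i, u), (j, w)) \<in> link_edges"
  shows "u \<in> {C1, C2, C3} \<and> w \<in> {C1, C2, C3}"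
proof -
  consider "((i, u), (j, w)) \<in> pair_edges P v1 v2" | "((i, u), (j, w)) \<in> cycle_edges k red y1 y2"
    using assms unfolding link_edges_def by blast
  then show ?thesis
  proof cases
    case 1
    then show ?thesis using pair_edges_ends by blast
  next
    case 2
    then show ?thesis using cycle_edges_ends[OF 2] by (auto split: if_splits)
  qed
qed

text \<open>Links attach only to C-vertices, and the extra edge of \<open>Y_graph\<close> joins two
  C-vertices. So the table of \<open>X_graph\<close> serves for A- and B-vertices in both kinds of
  copy.\<close>

lemma AB_arc_iff:
  assumes "u \<notin> {C1, C2, C3}"
  shows "(i, u) \<rightarrow>\<^bsub>cubic\<^esub> (j, w) \<longleftrightarrow> i < k \<and> j = i \<and> (u, w) \<in> parcs X_graph"
proof -
  have "((i, u), (j, w)) \<notin> link_edges" "((j, w), (i, u)) \<notin> link_edges"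
    using assms link_edges_ends by blast+
  moreover have "(u, w) \<in> parcs Y_graph \<longleftrightarrow> (u, w) \<in> parcs X_graph"
    using assms by (cases u) (auto simp: X_graph_arc_iff Y_graph_arc_iff)
  ultimately show ?thesis
    unfolding cubic_arc_iff by (auto simp: copy_edges_iff)
qed

text \<open>Pair edges join X-copies only, and cycle edges enter a Y-copy at \<open>C1\<close> or
  \<open>C3\<close>.\<close>

lemma Y_C2_arc:
  assumes arc: "(i, C2) \<rightarrow>\<^bsub>cubic\<^esub> (j, w)" and i: "i \<notin> red"
  shows "j = i \<and> w \<in> {B2, C1, C3}"
proof -
  have "((i, C2), (j, w)) \<notin> link_edges" "((j, w), (i, C2)) \<notin> link_edges"
    using i pair_edges_ends[of i C2 j w] pair_edges_ends[of j w i C2]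
      cycle_edges_ends[of i C2 j w] cycle_edges_ends[of j w i C2]
    by (auto simp: link_edges_def)
  then show ?thesis
    using arc i unfolding cubic_arc_iff by (auto simp: copy_edges_iff Y_graph_arc_iff)
qed

text \<open>Cycle edges meet an X-copy only in \<open>C1\<close>, so from \<open>C2\<close> and
  \<open>C3\<close> only pair edges leave the copy, and these match equal labels.\<close>

lemma X_arc:
  assumes arc: "(i, u) \<rightarrow>\<^bsub>cubic\<^esub> (j, w)" and i: "i \<in> red" and u: "u \<in> {C2, C3}"
  shows "j = i \<and> (u, w) \<in> parcs X_graph \<or>
    {i, j} \<in> P \<and> (u = v1 i \<and> w = v1 j \<or> u = v2 i \<and> w = v2 j)"
proof -
  have "((i, u), (j, w)) \<notin> cycle_edges k red y1 y2" "((j, w), (i, u)) \<notin> cycle_edges k red y1 y2"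
    using i u cycle_edges_ends[of i u j w] cycle_edges_ends[of j w i u] by auto
  then consider "((i, u), (j, w)) \<in> copy_edges k red" | "((i, u), (j, w)) \<in> pair_edges P v1 v2"
    | "((j, w), (i, u)) \<in> pair_edges P v1 v2"
    using arc unfolding cubic_arc_iff link_edges_def by blast
  then show ?thesis
  proof cases
    case 1
    then show ?thesis using i by (simp add: copy_edges_iff)
  next
    case 2
    then show ?thesis using pair_edges_ends by blast
  next
    case 3
    then show ?thesis using pair_edges_ends[OF 3] by (simp add: insert_commute) blast
  qed
qed

lemma C2_C3_adjacent:
  assumes "i \<in> red"
  shows "(i, C2) \<rightarrow>\<^bsub>cubic\<^esub> (i, C3)" "(i, C3) \<rightarrow>\<^bsub>cubic\<^esub> (i, C2)"
proof -
  have "i < k" using assms red_subset by blast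
  then show "(i, C2) \<rightarrow>\<^bsub>cubic\<^esub> (i, C3)" "(i, C3) \<rightarrow>\<^bsub>cubic\<^esub> (i, C2)"
    using assms unfolding cubic_arc_iff by (simp_all add: copy_edges_iff X_graph_arc_iff)
qed

text \<open>Prepares the contradiction in the X-case: the partner's two labelled vertices cannot
  both belong to an independent set.\<close>

lemma X_labels_adjacent:
  assumes "i \<in> red"
  shows "(i, v1 i) \<rightarrow>\<^bsub>cubic\<^esub> (i, v2 i)"
proof (cases rule: X_label_cases[OF assms])
  case 1
  then show ?thesis using C2_C3_adjacent(1)[OF assms] by simp
next
  case 2
  then show ?thesis using C2_C3_adjacent(2)[OF assms] by simp
qed

section \<open>Lower bound: three vertices in each copy\<close>

lemma copy_slice_card_ge_3:
  assumes S: "independent_dominating_set cubic S" and i: "i < k"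
  shows "3 \<le> card {u. (i, u) \<in> S}"
proof -
  define T where "T = {u. (i, u) \<in> S}"
  have ind: "\<not> p \<rightarrow>\<^bsub>cubic\<^esub> q" if "p \<in> S" "q \<in> S" for p q
    using S that by (auto simp: independent_dominating_set_def independent_set_def)
  have dom: "\<exists>j w. (j, w) \<in> S \<and> (i, u) \<rightarrow>\<^bsub>cubic\<^esub> (j, w)" if "u \<notin> T" for u
  proof -
    have "(i, u) \<in> verts cubic - S"
      using that i unfolding verts_cubic by (simp add: T_def)
    then show ?thesis
      using S unfolding independent_dominating_set_def by fast
  qed
  \<comment> \<open>A- and B-vertices have no neighbours outside their copy, so their domination can
    be tested within the slice \<open>T\<close>.\<close>
  have domAB: "\<exists>w\<in>T. (u, w) \<in> parcs X_graph" if "u \<notin> T" "u \<notin> {C1, C2, C3}" for u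
    using dom[OF that(1)] AB_arc_iff[OF that(2)] by (auto simp: T_def)
  have indAB: "(u, w) \<notin> parcs X_graph" if "u \<in> T" "w \<in> T" "u \<notin> {C1, C2, C3}" for u w
    using ind[of "(i, u)" "(i, w)"] that AB_arc_iff[OF that(3)] i by (auto simp: T_def)
  have three: "3 \<le> card T" if "{x, y, z} \<subseteq> T" "x \<noteq> y" "x \<noteq> z" "y \<noteq> z" for x y z
    using card_mono[OF finite_gadget_vertex_set that(1)] that(2-) by simp
  have "3 \<le> card T"
  proof (cases "T \<inter> {B1, B2, B3} = {}")
    case False
    then obtain b where "b \<in> T" "b \<in> {B1, B2, B3}" by blast
    then have "A1 \<notin> T" "A2 \<notin> T"
      using indAB[of A1 b] indAB[of A2 b] by (auto simp: X_graph_arc_iff)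
    then have "B1 \<in> T \<or> C1 \<in> T" "B2 \<in> T \<or> C2 \<in> T" "B3 \<in> T \<or> C3 \<in> T"
      using domAB[of B1] domAB[of B2] domAB[of B3] by (auto simp: X_graph_arc_iff)
    then obtain x y z where "x \<in> T" "x \<in> {B1, C1}" "y \<in> T" "y \<in> {B2, C2}" "z \<in> T" "z \<in> {B3, C3}"
      by blast
    then show ?thesis by (intro three[of x y z]) auto
  next
    case True
    \<comment> \<open>All neighbours of an A-vertex are B-vertices; with none of these in
      \<open>T\<close>, it must itself be chosen.\<close>
    then have A: "A1 \<in> T" "A2 \<in> T"
      using domAB[of A1] domAB[of A2] by (auto simp: X_graph_arc_iff)
    have "\<exists>c\<in>{C1, C2, C3}. c \<in> T"
    proof (rule ccontr)
      assume noC: "\<not> ?thesis"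
      show False
      proof (cases "i \<in> red")
        case False
        obtain j w where "(j, w) \<in> S" "(i, C2) \<rightarrow>\<^bsub>cubic\<^esub> (j, w)"
          using dom[of C2] noC by blast
        then show False
          using Y_C2_arc[OF _ False, of j w] noC True by (auto simp: T_def)
      next
        case red: True
        have lab: "v1 i \<in> {C2, C3}" "v2 i \<in> {C2, C3}" "v1 i \<noteq> v2 i"
          by (cases rule: X_label_cases[OF red]; simp)+
        obtain j w where j: "(j, w) \<in> S" "(i, v1 i) \<rightarrow>\<^bsub>cubic\<^esub> (j, w)"
          using dom[of "v1 i"] noC lab by auto
        obtain l x where l: "(l, x) \<in> S" "(i, v2 i) \<rightarrow>\<^bsub>cubic\<^esub> (l, x)"
          using dom[of "v2 i"] noC lab by auto
        \<comment> \<open>Inside the copy, \<open>C2\<close> and \<open>C3\<close> have only B- and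
          C-neighbours, none of them in \<open>S\<close>; hence the dominators \<open>(j, w)\<close>
          and \<open>(l, x)\<close> lie outside.\<close>
        have inside: False if "u \<in> {C2, C3}" "(u, t) \<in> parcs X_graph" "(i, t) \<in> S" for u t
          using that noC True by (auto simp: X_graph_arc_iff T_def)
        have j': "{i, j} \<in> P" "w = v1 j"
          using X_arc[OF j(2) red lab(1)] inside[OF lab(1), of w] j(1) lab(3) by auto
        have l': "{i, l} \<in> P" "x = v2 l"
          using X_arc[OF l(2) red lab(2)] inside[OF lab(2), of x] l(1) lab(3) by auto
        \<comment> \<open>The two dominators are the \<open>v1\<close>- and \<open>v2\<close>-vertex
          of the same partner copy, hence adjacent.\<close>
        have "l = j" using pair_unique j'(1) l'(1) by blast
        then show False
          using ind[OF j(1) l(1)] X_labels_adjacent[of j] pair_in_red[OF j'(1)] j'(2) l'(2)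
          by simp
      qed
    qed
    then obtain c where "c \<in> {C1, C2, C3}" "c \<in> T" by blast
    then show ?thesis using A by (intro three[of A1 A2 c]) auto
  qed
  then show ?thesis by (simp add: T_def)
qed

lemma independent_dominating_set_card_ge:
  assumes S: "independent_dominating_set cubic S"
  shows "3 * k \<le> card S"
proof -
  have "S \<subseteq> {..<k} \<times> UNIV"
    using S unfolding independent_dominating_set_def independent_set_def verts_cubic by blast
  \<comment> \<open>\<open>S\<close> is the disjoint union of its slices, so the bound per copy can
    be summed.\<close>
  then have "card S = card (SIGMA i:{..<k}. {u. (i, u) \<in> S})"
    by (intro arg_cong[where f = card]) auto
  also have "\<dots> = (\<Sum>i<k. card {u. (i, u) \<in> S})"
    by (simp add: finite_gadget_vertex_set)
  also have "\<dots> \<ge> (\<Sum>i<k. 3)"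
    using copy_slice_card_ge_3[OF S] by (intro sum_mono) auto
  finally show ?thesis by simp
qed

section \<open>Upper bound and exact value\<close>

lemma independent_dominating_set_B:
  "independent_dominating_set cubic ({..<k} \<times> {B1, B2, B3})"
proof -
  \<comment> \<open>A B-vertex is adjacent only to A-vertices and one C-vertex of its own copy;
    \<open>AB_arc_iff\<close> also rules out arcs between copies.\<close>
  have indep: "\<not> (i, u) \<rightarrow>\<^bsub>cubic\<^esub> (j, w)" if "u \<in> {B1, B2, B3}" "w \<in> {B1, B2, B3}" for i j u w
    using that AB_arc_iff[of u i j w] by (auto simp: X_graph_arc_iff)
  have dom: "\<exists>w\<in>{B1, B2, B3}. (i, u) \<rightarrow>\<^bsub>cubic\<^esub> (i, w)" if "i < k" "u \<notin> {B1, B2, B3}" for i u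
    using that unfolding cubic_arc_iff
    by (cases u) (auto simp: copy_edges_iff X_graph_arc_iff Y_graph_arc_iff)
  show ?thesis
    unfolding independent_dominating_set_def independent_set_def verts_cubic
  proof (intro conjI ballI)
    fix p assume "p \<in> {..<k} \<times> UNIV - {..<k} \<times> {B1, B2, B3}"
    then obtain i u where p: "p = (i, u)" "i < k" "u \<notin> {B1, B2, B3}" by blast
    then obtain w where "w \<in> {B1, B2, B3}" "(i, u) \<rightarrow>\<^bsub>cubic\<^esub> (i, w)"
      using dom by blast
    then show "\<exists>q\<in>{..<k} \<times> {B1, B2, B3}. p \<rightarrow>\<^bsub>cubic\<^esub> q"
      using p by (intro bexI[of _ "(i, w)"]) auto
  next
    fix p q assume "p \<in> {..<k} \<times> {B1, B2, B3}" "q \<in> {..<k} \<times> {B1, B2, B3}"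
    then show "\<not> p \<rightarrow>\<^bsub>cubic\<^esub> q"
      using indep[of "snd p" "snd q" "fst p" "fst q"] by (simp add: mem_Times_iff)
  qed blast
qed

lemma independent_domination_number_cubic: "independent_domination_number cubic = 3 * k"
  unfolding independent_domination_number_def
proof (rule Min_eqI)
  \<comment> \<open>\<open>Min\<close> is characterised by its least element only on a finite set;
    here finiteness comes from the finite vertex set.\<close>
  have "{card S | S. independent_dominating_set cubic S} \<subseteq> card ` Pow (verts cubic)"
    by (auto simp: independent_dominating_set_def independent_set_def)
  moreover have "finite (verts cubic)"
    unfolding verts_cubic by (simp add: UNIV_gadget_vertex)
  ultimately show "finite {card S | S. independent_dominating_set cubic S}"
    by (meson finite_Pow_iff finite_imageI finite_subset)
  show "3 * k \<in> {card S | S. independent_dominating_set cubic S}"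
    using independent_dominating_set_B by (force simp: card_cartesian_product)
next
  fix m assume "m \<in> {card S | S. independent_dominating_set cubic S}"
  then show "3 * k \<le> m" using independent_dominating_set_card_ge by blast
qed

lemma card_verts_cubic: "card (verts cubic) = 8 * k"
  unfolding verts_cubic by (simp add: card_cartesian_product UNIV_gadget_vertex)

end

theorem theorem4:
  fixes G :: "('a, 'b) pre_digraph" and n :: nat
  assumes "G \<in> F_cubic"
    and "n = card (verts G)"
  shows "n \<ge> 16 \<and> [n = 0] (mod 8) \<and> real (independent_domination_number G) = 3 / 8 * real n"
proof -
  obtain k red P v1 v2 y1 y2 f where cc: "cubic_construction k red P v1 v2 y1 y2"
    and iso: "pre_digraph.digraph_isomorphism (with_proj (cubic_graph k red P v1 v2 y1 y2)) f"
    and G: "G = app_iso f (with_proj (cubic_graph k red P v1 v2 y1 y2))"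
    using assms(1) unfolding F_cubic_def digraph_iso_def by blast
  interpret cubic_construction k red P v1 v2 y1 y2 by (fact cc)
  have "n = 8 * k"
    using assms(2) card_verts_cubic
      card_image[OF pre_digraph.digraph_isomorphism_inj_on_verts[OF iso]]
    by (simp add: G)
  moreover have "independent_domination_number G = 3 * k"
    unfolding G using independent_domination_number_app_iso[OF iso]
      independent_domination_number_cubic by simp
  \<comment> \<open>Only arithmetic remains: \<open>k_ge_2\<close> turns \<open>n = 8 * k\<close>
    into the bound 16, and \<open>3 * k\<close> is three eighths of \<open>n\<close>.\<close>
  ultimately show ?thesis
    using k_ge_2 by (simp add: cong_def)
qed

end
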